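(* Let $(T_i)_{i=1}^{\infty}$ be a sequence of bounded linear operators from a Banach space $X$ to a normed linear space $Y$. Then either $(T_i)_{i=1}^{\infty}$ is mean equicontinuous or $(T_i)_{i=1}^{\infty}$ is mean sensitive.
   Context: A sequence $(T_i)_{i=1}^{\infty}$ of linear operators from a normed linear space $X$ to a normed linear space $Y$ is \emph{mean equicontinuous} if for every $\varepsilon>0$ there exists $\delta>0$ such that for all $x,y\in X$ with $\Vert x-y\Vert<\delta$, $\limsup_{n\to\infty}\frac{1}{n}\sum_{i=1}^{n}\Vert T_ix-T_iy\Vert<\varepsilon$. It is \emph{mean sensitive} if there is a constant $\delta>0$ such that for every $x\in X$ and $\varepsilon>0$ there exists $y\in X$ with $\Vert x-y\Vert<\varepsilon$ and $\limsup_{n\to\infty}\frac{1}{n}\sum_{i=1}^{n}\Vert T_ix-T_iy\Vert>\delta$. *)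

theory Defs
  imports "HOL-Analysis.Analysis"
begin

text \<open>
  The averages of a sequence of operators need not be bounded, so the limit superior is taken
  in \<^typ>\<open>ereal\<close>, where it may be \<open>\<infinity>\<close>. Sequences are indexed from 1 and the value
  \<open>T 0\<close> is never used; the term for \<open>n = 0\<close> (which is \<open>0 / 0 = 0\<close>) does not affect the
  limit superior.
\<close>

definition mean_limsup ::
  "(nat \<Rightarrow> 'a \<Rightarrow> 'b::real_normed_vector) \<Rightarrow> 'a \<Rightarrow> 'a \<Rightarrow> ereal" where
  "mean_limsup T x y =
     limsup (\<lambda>n. ereal (1 / real n * (\<Sum>i=1..n. norm (T i x - T i y))))"

definition mean_equicontinuous ::
  "(nat \<Rightarrow> 'a::real_normed_vector \<Rightarrow> 'b::real_normed_vector) \<Rightarrow> bool" where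
  "mean_equicontinuous T \<longleftrightarrow>
     (\<forall>\<epsilon>::real. \<epsilon> > 0 \<longrightarrow>
       (\<exists>\<delta>::real. \<delta> > 0 \<and>
         (\<forall>x y. norm (x - y) < \<delta> \<longrightarrow> mean_limsup T x y < ereal \<epsilon>)))"

definition mean_sensitive ::
  "(nat \<Rightarrow> 'a::real_normed_vector \<Rightarrow> 'b::real_normed_vector) \<Rightarrow> bool" where
  "mean_sensitive T \<longleftrightarrow>
     (\<exists>\<delta>::real. \<delta> > 0 \<and>
       (\<forall>x. \<forall>\<epsilon>::real. \<epsilon> > 0 \<longrightarrow>
         (\<exists>y. norm (x - y) < \<epsilon> \<and> mean_limsup T x y > ereal \<delta>)))"

end

theory Submission
  imports Defs
begin

text \<open>
  By linearity \<open>mean_limsup T x y\<close> depends only on \<open>x - y\<close>. A failure of mean equicontinuity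
  therefore gives arbitrarily small vectors \<open>a - b\<close> along which the mean limit superior is
  bounded below, and these can be translated to any base point.
\<close>

lemma mean_limsup_cong_diff:
  fixes T :: "nat \<Rightarrow> 'a::real_normed_vector \<Rightarrow> 'b::real_normed_vector"
  assumes "\<And>i. i \<ge> 1 \<Longrightarrow> linear (T i)" and "x - y = a - b"
  shows "mean_limsup T x y = mean_limsup T a b"
proof -
  have "T i x - T i y = T i a - T i b" if "i \<ge> 1" for i
    using assms that by (metis linear_diff)
  then show ?thesis
    unfolding mean_limsup_def by simp
qed

theorem theorem2p2:
  fixes T :: "nat \<Rightarrow> 'a::banach \<Rightarrow> 'b::real_normed_vector"
  assumes "\<And>i. i \<ge> 1 \<Longrightarrow> bounded_linear (T i)"
  shows "(mean_equicontinuous T \<or> mean_sensitive T) \<and>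
         \<not> (mean_equicontinuous T \<and> mean_sensitive T)"
proof
  have lin: "linear (T i)" if "i \<ge> 1" for i
    using assms that by (simp add: bounded_linear.linear)
  have "mean_sensitive T" if not_eq: "\<not> mean_equicontinuous T"
  proof -
    obtain e :: real where e: "e > 0"
      and bad: "\<And>d. d > 0 \<Longrightarrow> \<exists>a b. norm (a - b) < d \<and> mean_limsup T a b \<ge> ereal e"
      using not_eq unfolding mean_equicontinuous_def by (metis not_less)
    \<comment> \<open>The failure of equicontinuity gives only the weak bound
      \<open>\<ge> ereal e\<close>, whereas sensitivity asks for a strict one; hence the constant
      \<open>e / 2\<close>.\<close>
    have "\<exists>y. norm (x - y) < d \<and> mean_limsup T x y > ereal (e / 2)" if "d > 0" for x d
    proof -
      obtain a b where ab: "norm (a - b) < d" "mean_limsup T a b \<ge> ereal e"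
        using bad \<open>d > 0\<close> by blast
      have "mean_limsup T x (x - (a - b)) = mean_limsup T a b"
        by (rule mean_limsup_cong_diff) (simp_all add: lin)
      moreover have "ereal (e / 2) < ereal e"
        using e by simp
      ultimately have "mean_limsup T x (x - (a - b)) > ereal (e / 2)"
        using ab(2) by (metis less_le_trans)
      then show ?thesis
        using ab(1) by (intro exI[of _ "x - (a - b)"]) simp
    qed
    then show ?thesis
      unfolding mean_sensitive_def using e by (intro exI[of _ "e / 2"]) simp
  qed
  then show "mean_equicontinuous T \<or> mean_sensitive T"
    by blast
  \<comment> \<open>Use the sensitivity constant as the \<epsilon> of equicontinuity, and the
    \<delta> so obtained as the radius in sensitivity at any base point: the resulting pair has its
    mean limit superior both below and above that constant.\<close>
  show "\<not> (mean_equicontinuous T \<and> mean_sensitive T)"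
    unfolding mean_equicontinuous_def mean_sensitive_def by (meson less_asym)
qed

end
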